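(* Let $\mathcal{X}$ be an $N$-order tensor with all mode lengths equal to $I$ (that is, $I_1=\cdots=I_N=I$) and with set of observable entries $\Omega$, and let the core tensor have all mode lengths equal to $J$ (that is, $J_1=\cdots=J_N=J$). Then the time complexity of one iteration of the P-Tucker algorithm is $O(NIJ^3+N^2|\Omega|J^N)$.
   Context: Time is measured as the total number of elementary operations (summed over all threads); inverting a $J\times J$ matrix is counted as $O(J^3)$. Data: tensor $\mathcal{X}$ with observable index tuples $\Omega\subseteq\{1,\dots,I\}^N$, factor matrices $\mathbf{A}^{(n)}=(a^{(n)}_{ij})\in\mathbb{R}^{I\times J}$ ($n=1,\dots,N$), core tensor $\mathcal{G}\in\mathbb{R}^{J\times\cdots\times J}$ of order $N$, regularization parameter $\lambda>0$. $\Omega^{(n)}_{i_n}$ is the set of tuples in $\Omega$ with $n$th coordinate $i_n$. One iteration of P-Tucker consists of two parts. (1) Updating factor matrices. For each $n=1,\dots,N$ and each row $i_n=1,\dots,I$: for each $\alpha=(i_1,\dots,i_N)\in\Omega^{(n)}_{i_n}$, compute the vector $\delta^{(n)}_\alpha\in\mathbb{R}^J$ by looping over all $\beta=(j_1,\dots,j_N)\in\{1,\dots,J\}^N$ and adding the product $\mathcal{G}_\beta\prod_{k\ne n}a^{(k)}_{i_kj_k}$ (computed directly) to $\delta^{(n)}_\alpha(j_n)$; then accumulate $\mathbf{B}^{(n)}_{i_n}\in\mathbb{R}^{J\times J}$, with entries $\sum_{\alpha\in\Omega^{(n)}_{i_n}}\delta^{(n)}_\alpha(j)\delta^{(n)}_\alpha(j')$,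 and $\mathbf{c}^{(n)}_{i_n:}\in\mathbb{R}^{J}$, with entries $\sum_{\alpha\in\Omega^{(n)}_{i_n}}\mathcal{X}_\alpha\delta^{(n)}_\alpha(j)$. Then invert $\mathbf{B}^{(n)}_{i_n}+\lambda\mathbf{I}_J$ and replace the $i_n$th row of $\mathbf{A}^{(n)}$ by $\mathbf{c}^{(n)}_{i_n:}[\mathbf{B}^{(n)}_{i_n}+\lambda\mathbf{I}_J]^{-1}$. (2) Computing the reconstruction error $\Bigl(\sum_{(i_1,\dots,i_N)\in\Omega}\bigl(\mathcal{X}_{(i_1,\dots,i_N)}-\sum_{(j_1,\dots,j_N)}\mathcal{G}_{(j_1,\dots,j_N)}\prod_{n=1}^N a^{(n)}_{i_nj_n}\bigr)^2\Bigr)^{1/2}$ directly from this formula. *)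

theory Defs
  imports
    "HOL-Library.Landau_Symbols"
    "HOL-Library.Monad_Syntax"
    "Jordan_Normal_Form.Gauss_Jordan_Elimination"
begin

text \<open>
  Indices start at 0, so a tuple of \<open>{1..I}^N\<close> is a list of length \<open>N\<close> with entries below \<open>I\<close>.
  An order-\<open>N\<close> tensor is a function on such lists. A collection of factor matrices is a function
  \<open>A\<close> with \<open>A n i j\<close> the entry \<open>(i, j)\<close> of the \<open>n\<close>-th matrix. Vectors and matrices of size \<open>J\<close> are
  functions of which only the indices below \<open>J\<close> matter.
\<close>

definition tuples :: "nat \<Rightarrow> nat \<Rightarrow> nat list set" where
  "tuples N I = {\<alpha>. length \<alpha> = N \<and> set \<alpha> \<subseteq> {..<I}}"

definition enumerates :: "'a list \<Rightarrow> 'a set \<Rightarrow> bool" where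
  "enumerates xs S \<longleftrightarrow> distinct xs \<and> set xs = S"

type_synonym factors = "nat \<Rightarrow> nat \<Rightarrow> nat \<Rightarrow> real"

section \<open>Computations that count elementary operations\<close>

datatype 'a timed = Timed (val: 'a) (cost: nat)

definition bind_timed :: "'a timed \<Rightarrow> ('a \<Rightarrow> 'b timed) \<Rightarrow> 'b timed" where
  "bind_timed m f = Timed (val (f (val m))) (cost m + cost (f (val m)))"

adhoc_overloading Monad_Syntax.bind \<rightleftharpoons> bind_timed

definition ret :: "'a \<Rightarrow> 'a timed" where
  "ret x = Timed x 0"

definition charge :: "nat \<Rightarrow> unit timed" where
  "charge t = Timed () t"

text \<open>
  \<open>step\<close> is one elementary operation: one exact real arithmetic operation (including the square
  root), or one read or write of an array cell. All of the algorithm below is written with at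
  most one such operation inside each \<open>step\<close>.
\<close>

definition step :: "'a \<Rightarrow> 'a timed" where
  "step x = Timed x 1"

text \<open>Every evaluation of the loop test costs 1, including the final one.\<close>

fun for_each :: "'b list \<Rightarrow> ('b \<Rightarrow> 's \<Rightarrow> 's timed) \<Rightarrow> 's \<Rightarrow> 's timed" where
  "for_each [] body s = step s"
| "for_each (x # xs) body s = do { charge 1; s' \<leftarrow> body x s; for_each xs body s' }"

text \<open>Locating a cell of an order-\<open>N\<close> tensor takes \<open>N\<close> operations.\<close>

definition read_tensor :: "nat \<Rightarrow> (nat list \<Rightarrow> real) \<Rightarrow> nat list \<Rightarrow> real timed" where
  "read_tensor N T \<alpha> = do { charge N; step (T \<alpha>) }"

text \<open>
  The loop over all \<open>\<beta> \<in> {0..<J}^N\<close>; moving to the next tuple changes up to \<open>N\<close> coordinates.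
\<close>

definition for_each_tuple :: "nat \<Rightarrow> nat \<Rightarrow> (nat list \<Rightarrow> 's \<Rightarrow> 's timed) \<Rightarrow> 's \<Rightarrow> 's timed" where
  "for_each_tuple N J body =
     for_each (List.n_lists N [0..<J]) (\<lambda>\<beta> s. do { charge N; body \<beta> s })"

definition init_vec :: "nat \<Rightarrow> (nat \<Rightarrow> real) timed" where
  "init_vec J = do { charge J; ret (\<lambda>_. 0) }"

definition init_mat :: "nat \<Rightarrow> (nat \<Rightarrow> nat \<Rightarrow> real) timed" where
  "init_mat J = do { charge (J * J); ret (\<lambda>_ _. 0) }"

text \<open>
  Inversion is a subroutine whose running time \<open>inv_cost\<close> is a parameter of the cost model.
\<close>

definition invert :: "(nat \<Rightarrow> nat) \<Rightarrow> nat \<Rightarrow> (nat \<Rightarrow> nat \<Rightarrow> real) \<Rightarrow> (nat \<Rightarrow> nat \<Rightarrow> real) timed" where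
  "invert inv_cost J M =
     Timed (\<lambda>j j'. the (mat_inverse (mat J J (\<lambda>(p, q). M p q))) $$ (j, j')) (inv_cost J)"

section \<open>Updating the factor matrices\<close>

text \<open>The product of the core entry at \<open>\<beta>\<close> with the factor entries of the modes listed in \<open>ks\<close>.\<close>

definition core_product ::
    "nat \<Rightarrow> (nat list \<Rightarrow> real) \<Rightarrow> factors \<Rightarrow> nat list \<Rightarrow> nat list \<Rightarrow> nat list \<Rightarrow> real timed" where
  "core_product N G A ks \<alpha> \<beta> = do {
     g \<leftarrow> read_tensor N G \<beta>;
     for_each ks (\<lambda>k p. do {
       i \<leftarrow> step (\<alpha> ! k);
       j \<leftarrow> step (\<beta> ! k);
       a \<leftarrow> step (A k i j);
       step (p * a)
     }) g
   }"

definition compute_delta ::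
    "nat \<Rightarrow> nat \<Rightarrow> (nat list \<Rightarrow> real) \<Rightarrow> factors \<Rightarrow> nat \<Rightarrow> nat list \<Rightarrow> (nat \<Rightarrow> real) timed" where
  "compute_delta N J G A n \<alpha> = do {
     \<delta>\<^sub>0 \<leftarrow> init_vec J;
     for_each_tuple N J (\<lambda>\<beta> \<delta>. do {
       p \<leftarrow> core_product N G A ([0..<n] @ [Suc n..<N]) \<alpha> \<beta>;
       j \<leftarrow> step (\<beta> ! n);
       d \<leftarrow> step (\<delta> j);
       s \<leftarrow> step (d + p);
       step (\<delta>(j := s))
     }) \<delta>\<^sub>0
   }"

definition accumulate_B ::
    "nat \<Rightarrow> (nat \<Rightarrow> real) \<Rightarrow> (nat \<Rightarrow> nat \<Rightarrow> real) \<Rightarrow> (nat \<Rightarrow> nat \<Rightarrow> real) timed" where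
  "accumulate_B J \<delta> B\<^sub>0 =
     for_each [0..<J] (\<lambda>j. for_each [0..<J] (\<lambda>j' B. do {
       x \<leftarrow> step (\<delta> j);
       y \<leftarrow> step (\<delta> j');
       p \<leftarrow> step (x * y);
       b \<leftarrow> step (B j j');
       s \<leftarrow> step (b + p);
       step (B(j := (B j)(j' := s)))
     })) B\<^sub>0"

definition accumulate_c ::
    "nat \<Rightarrow> real \<Rightarrow> (nat \<Rightarrow> real) \<Rightarrow> (nat \<Rightarrow> real) \<Rightarrow> (nat \<Rightarrow> real) timed" where
  "accumulate_c J x \<delta> c\<^sub>0 =
     for_each [0..<J] (\<lambda>j c. do {
       y \<leftarrow> step (\<delta> j);
       p \<leftarrow> step (x * y);
       b \<leftarrow> step (c j);
       s \<leftarrow> step (b + p);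
       step (c(j := s))
     }) c\<^sub>0"

text \<open>The argument \<open>\<alpha>s\<close> lists the observable tuples whose \<open>n\<close>-th coordinate is the current row.\<close>

definition normal_equations ::
    "nat \<Rightarrow> nat \<Rightarrow> (nat list \<Rightarrow> real) \<Rightarrow> (nat list \<Rightarrow> real) \<Rightarrow> factors \<Rightarrow> nat \<Rightarrow> nat list list
      \<Rightarrow> ((nat \<Rightarrow> nat \<Rightarrow> real) \<times> (nat \<Rightarrow> real)) timed" where
  "normal_equations N J X G A n \<alpha>s = do {
     B\<^sub>0 \<leftarrow> init_mat J;
     c\<^sub>0 \<leftarrow> init_vec J;
     for_each \<alpha>s (\<lambda>\<alpha> (B, c). do {
       \<delta> \<leftarrow> compute_delta N J G A n \<alpha>;
       B' \<leftarrow> accumulate_B J \<delta> B;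
       x \<leftarrow> read_tensor N X \<alpha>;
       c' \<leftarrow> accumulate_c J x \<delta> c;
       ret (B', c')
     }) (B\<^sub>0, c\<^sub>0)
   }"

definition add_to_diagonal ::
    "nat \<Rightarrow> real \<Rightarrow> (nat \<Rightarrow> nat \<Rightarrow> real) \<Rightarrow> (nat \<Rightarrow> nat \<Rightarrow> real) timed" where
  "add_to_diagonal J lam B\<^sub>0 =
     for_each [0..<J] (\<lambda>j B. do {
       b \<leftarrow> step (B j j);
       s \<leftarrow> step (b + lam);
       step (B(j := (B j)(j := s)))
     }) B\<^sub>0"

text \<open>Row \<open>i\<close> of the \<open>n\<close>-th factor matrix becomes the row vector \<open>c\<close> times \<open>M\<close>.\<close>

definition write_row ::
    "nat \<Rightarrow> nat \<Rightarrow> nat \<Rightarrow> (nat \<Rightarrow> real) \<Rightarrow> (nat \<Rightarrow> nat \<Rightarrow> real) \<Rightarrow> factors \<Rightarrow> factors timed" where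
  "write_row J n i c M A\<^sub>0 =
     for_each [0..<J] (\<lambda>j A. do {
       s \<leftarrow> for_each [0..<J] (\<lambda>j' s. do {
         x \<leftarrow> step (c j');
         y \<leftarrow> step (M j' j);
         p \<leftarrow> step (x * y);
         step (s + p)
       }) 0;
       step (A(n := (A n)(i := (A n i)(j := s))))
     }) A\<^sub>0"

definition update_row ::
    "(nat \<Rightarrow> nat) \<Rightarrow> nat \<Rightarrow> nat \<Rightarrow> (nat list \<Rightarrow> real) \<Rightarrow> (nat list \<Rightarrow> real) \<Rightarrow> real
      \<Rightarrow> nat \<Rightarrow> nat \<Rightarrow> nat list list \<Rightarrow> factors \<Rightarrow> factors timed" where
  "update_row inv_cost N J X G lam n i \<alpha>s A = do {
     (B, c) \<leftarrow> normal_equations N J X G A n \<alpha>s;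
     R \<leftarrow> add_to_diagonal J lam B;
     M \<leftarrow> invert inv_cost J R;
     write_row J n i c M A
   }"

text \<open>
  \<open>slices n i\<close> lists the observable tuples with \<open>n\<close>-th coordinate \<open>i\<close>. These lists belong to the
  input, so that the observable entries are not searched for every row.
\<close>

definition update_factors ::
    "(nat \<Rightarrow> nat) \<Rightarrow> nat \<Rightarrow> nat \<Rightarrow> nat \<Rightarrow> (nat list \<Rightarrow> real) \<Rightarrow> (nat \<Rightarrow> nat \<Rightarrow> nat list list)
      \<Rightarrow> (nat list \<Rightarrow> real) \<Rightarrow> real \<Rightarrow> factors \<Rightarrow> factors timed" where
  "update_factors inv_cost N I J X slices G lam A\<^sub>0 =
     for_each [0..<N] (\<lambda>n. for_each [0..<I] (\<lambda>i A.
       update_row inv_cost N J X G lam n i (slices n i) A)) A\<^sub>0"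

section \<open>The reconstruction error\<close>

definition reconstruct ::
    "nat \<Rightarrow> nat \<Rightarrow> (nat list \<Rightarrow> real) \<Rightarrow> factors \<Rightarrow> nat list \<Rightarrow> real timed" where
  "reconstruct N J G A \<alpha> =
     for_each_tuple N J (\<lambda>\<beta> s. do {
       p \<leftarrow> core_product N G A [0..<N] \<alpha> \<beta>;
       step (s + p)
     }) 0"

definition reconstruction_error ::
    "nat \<Rightarrow> nat \<Rightarrow> (nat list \<Rightarrow> real) \<Rightarrow> nat list list \<Rightarrow> (nat list \<Rightarrow> real) \<Rightarrow> factors \<Rightarrow> real timed" where
  "reconstruction_error N J X obs G A = do {
     e \<leftarrow> for_each obs (\<lambda>\<alpha> s. do {
       x \<leftarrow> read_tensor N X \<alpha>;
       r \<leftarrow> reconstruct N J G A \<alpha>;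
       d \<leftarrow> step (x - r);
       q \<leftarrow> step (d * d);
       step (s + q)
     }) 0;
     step (sqrt e)
   }"

section \<open>One iteration\<close>

definition ptucker_iteration ::
    "(nat \<Rightarrow> nat) \<Rightarrow> nat \<Rightarrow> nat \<Rightarrow> nat \<Rightarrow> (nat list \<Rightarrow> real) \<Rightarrow> nat list list
      \<Rightarrow> (nat \<Rightarrow> nat \<Rightarrow> nat list list) \<Rightarrow> (nat list \<Rightarrow> real) \<Rightarrow> real \<Rightarrow> factors
      \<Rightarrow> (factors \<times> real) timed" where
  "ptucker_iteration inv_cost N I J X obs slices G lam A = do {
     A' \<leftarrow> update_factors inv_cost N I J X slices G lam A;
     err \<leftarrow> reconstruction_error N J X obs G A';
     ret (A', err)
   }"

end

theory Submission
  imports Defs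
begin

text \<open>
  For \<open>N \<ge> 2\<close> the accumulation of \<open>B\<close> costs \<open>O(J\<^sup>2)\<close> per observable entry and mode, which
  is absorbed by the cost \<open>O(N J\<^sup>N)\<close> of computing \<open>\<delta>\<close>. This fails for \<open>N = 1\<close>, but then
  there are at most \<open>I\<close> observable entries and the accumulation is absorbed by the term
  \<open>N I J\<^sup>3\<close>. Updating all rows of one factor matrix visits every observable entry exactly once.
\<close>

section \<open>Costs of the primitives and of the loops\<close>

lemma cost_simps [simp]:
  "cost (bind_timed m f) = cost m + cost (f (val m))"
  "cost (ret x) = 0"
  "cost (charge t) = t"
  "cost (step x) = 1"
  "cost (read_tensor N T \<alpha>) = N + 1"
  "cost (init_vec J) = J"
  "cost (init_mat J) = J * J"
  "cost (invert inv_cost J M) = inv_cost J"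
  by (simp_all add: bind_timed_def ret_def charge_def step_def read_tensor_def init_vec_def
      init_mat_def invert_def)

text \<open>The bound on the body holds for every loop state, so no invariant about computed values
  has to be tracked. It may depend on the element because slices differ in length. The 1 in each
  summand is a successful loop test, the last 1 the failing test.\<close>

lemma cost_for_each_le_sum_list:
  assumes "\<And>x s. x \<in> set xs \<Longrightarrow> cost (body x s) \<le> f x"
  shows "cost (for_each xs body s) \<le> (\<Sum>x\<leftarrow>xs. f x + 1) + 1"
  using assms
proof (induction xs arbitrary: s)
  case (Cons x xs)
  have "cost (body x s) \<le> f x"
    by (simp add: Cons.prems)
  moreover have "cost (for_each xs body (val (body x s))) \<le> (\<Sum>x\<leftarrow>xs. f x + 1) + 1"
    using Cons by simp
  ultimately show ?case by simp
qed simp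

lemma cost_for_each_le:
  assumes "\<And>x s. x \<in> set xs \<Longrightarrow> cost (body x s) \<le> c"
  shows "cost (for_each xs body s) \<le> length xs * (c + 1) + 1"
  using cost_for_each_le_sum_list[of xs body "\<lambda>_. c"] assms
  by (simp add: sum_list_triv)

lemma cost_for_each_tuple_le:
  assumes "\<And>\<beta> s. cost (body \<beta> s) \<le> c"
  shows "cost (for_each_tuple N J body s) \<le> J ^ N * (N + c + 1) + 1"
  unfolding for_each_tuple_def
  by (rule order.trans[OF cost_for_each_le[where c = "N + c"]])
    (use assms in \<open>auto simp: length_n_lists\<close>)

text \<open>Reading the core entry takes \<open>N + 1\<close>, each mode four steps and a loop test,
  and the final test 1.\<close>

lemma cost_core_product_le:
  "cost (core_product N G A ks \<alpha> \<beta>) \<le> N + 5 * length ks + 2"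
  unfolding core_product_def
  by (simp, rule order.trans[OF cost_for_each_le[where c = 4]]) auto

text \<open>These inequalities let \<open>linarith\<close>, for which the powers and products are
  atoms, absorb lower-order terms into \<open>N * J ^ N\<close>. The instance \<open>N = 2\<close>
  does the same for \<open>J\<^sup>2\<close>.\<close>

lemma self_le_power_nat:
  fixes J N :: nat
  assumes "N \<ge> 1" "J \<ge> 1"
  shows "J \<le> J ^ N" "1 \<le> J ^ N" "N \<le> N * J ^ N" "J \<le> N * J ^ N" "J ^ N \<le> N * J ^ N"
    "1 \<le> N * J ^ N"
proof -
  show 1: "J \<le> J ^ N" using assms by (simp add: self_le_power)
  show 2: "1 \<le> J ^ N" using assms by simp
  show 3: "N \<le> N * J ^ N" "J ^ N \<le> N * J ^ N" using assms 2 by simp_all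
  show "J \<le> N * J ^ N" "1 \<le> N * J ^ N" using assms 1 2 3 by linarith+
qed

section \<open>Cost of updating one row\<close>

lemma cost_compute_delta_le:
  assumes "N \<ge> 1" "J \<ge> 1" "n < N"
  shows "cost (compute_delta N J G A n \<alpha>) \<le> 16 * (N * J ^ N)"
proof -
  have core: "cost (core_product N G A ([0..<n] @ [Suc n..<N]) \<alpha> \<beta>) \<le> 6 * N + 2" for \<beta>
    by (rule order.trans[OF cost_core_product_le]) (use \<open>n < N\<close> in simp)
  \<comment> \<open>Here \<open>6 * N + 6\<close> is the core product together with the four steps
    that add it to \<delta>.\<close>
  have "cost (compute_delta N J G A n \<alpha>) \<le> J + (J ^ N * (N + (6 * N + 6) + 1) + 1)"
    unfolding compute_delta_def cost_simps
    by (intro add_mono order.refl cost_for_each_tuple_le) (use core in simp)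
  also have "\<dots> = J + 7 * (N * J ^ N) + 7 * J ^ N + 1"
    by (simp add: algebra_simps)
  finally show ?thesis
    using self_le_power_nat[OF assms(1,2)] by linarith
qed

lemma cost_accumulate_B_le:
  assumes "J \<ge> 1"
  shows "cost (accumulate_B J \<delta> B) \<le> 10 * J\<^sup>2"
proof -
  have "cost (accumulate_B J \<delta> B) \<le> length [0..<J] * (length [0..<J] * (6 + 1) + 1 + 1) + 1"
    unfolding accumulate_B_def by (intro cost_for_each_le) simp
  also have "\<dots> = 7 * J\<^sup>2 + 2 * J + 1"
    by (simp add: algebra_simps power2_eq_square)
  finally show ?thesis
    using self_le_power_nat[of 2 J] assms by linarith
qed

lemma cost_accumulate_c_le:
  "cost (accumulate_c J x \<delta> c) \<le> 6 * J + 1"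
  unfolding accumulate_c_def
  by (rule order.trans[OF cost_for_each_le[where c = 5]]) auto

text \<open>The term \<open>10 * J\<^sup>2\<close> per entry stays separate from
  \<open>N * J ^ N\<close>, since for \<open>N = 1\<close> it is not dominated by it uniformly in
  \<open>J\<close>. Initialization and the last loop test fit into
  \<open>3 * J\<^sup>2\<close>.\<close>

lemma cost_normal_equations_le:
  assumes "N \<ge> 1" "J \<ge> 1" "n < N"
  shows "cost (normal_equations N J X G A n \<alpha>s)
    \<le> 3 * J\<^sup>2 + length \<alpha>s * (26 * (N * J ^ N) + 10 * J\<^sup>2)"
proof -
  \<comment> \<open>The remainder \<open>N + 6 * J + 3\<close> is at most ten copies of
    \<open>N * J ^ N\<close>.\<close>
  have body: "16 * (N * J ^ N) + 10 * J\<^sup>2 + (N + 1) + (6 * J + 1) + 1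
      \<le> 26 * (N * J ^ N) + 10 * J\<^sup>2"
    using self_le_power_nat[OF assms(1,2)] by linarith
  have "cost (normal_equations N J X G A n \<alpha>s)
      \<le> J * J + (J + (length \<alpha>s * (16 * (N * J ^ N) + 10 * J\<^sup>2 + (N + 1) + (6 * J + 1) + 1) + 1))"
    unfolding normal_equations_def cost_simps
  proof (intro add_mono order.refl cost_for_each_le, clarify)
    fix \<alpha> :: "nat list" and B c
    show "cost (do {
        \<delta> \<leftarrow> compute_delta N J G A n \<alpha>;
        B' \<leftarrow> accumulate_B J \<delta> B;
        x \<leftarrow> read_tensor N X \<alpha>;
        c' \<leftarrow> accumulate_c J x \<delta> c;
        ret (B', c')
      }) \<le> 16 * (N * J ^ N) + 10 * J\<^sup>2 + (N + 1) + (6 * J + 1)"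
      unfolding cost_simps add_0_right add.assoc
      by (intro add_mono order.refl cost_compute_delta_le cost_accumulate_B_le
          cost_accumulate_c_le assms)
  qed
  also have "\<dots> \<le> J * J + (J + (length \<alpha>s * (26 * (N * J ^ N) + 10 * J\<^sup>2) + 1))"
    using mult_le_mono2[OF body, of "length \<alpha>s"]
    by (simp only: add_le_cancel_left add_le_cancel_right)
  finally show ?thesis
    using self_le_power_nat[of 2 J] \<open>J \<ge> 1\<close> unfolding power2_eq_square by linarith
qed

lemma cost_add_to_diagonal_le:
  "cost (add_to_diagonal J lam B) \<le> 4 * J + 1"
  unfolding add_to_diagonal_def
  by (rule order.trans[OF cost_for_each_le[where c = 3]]) auto

lemma cost_write_row_le:
  assumes "J \<ge> 1"
  shows "cost (write_row J n i c M A) \<le> 9 * J\<^sup>2"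
proof -
  have "cost (write_row J n i c M A) \<le> length [0..<J] * (length [0..<J] * (4 + 1) + 1 + 1 + 1) + 1"
    unfolding write_row_def cost_simps
    by (intro cost_for_each_le) (simp only: cost_simps, intro add_mono cost_for_each_le; simp)
  also have "\<dots> = 5 * J\<^sup>2 + 3 * J + 1"
    by (simp add: algebra_simps power2_eq_square)
  finally show ?thesis
    using self_le_power_nat[of 2 J] assms by linarith
qed

text \<open>The constant 17 is 3 for initialization, 5 for the diagonal and 9 for writing the row.
  The inversion cost is carried along unevaluated.\<close>

lemma cost_update_row_le:
  assumes "N \<ge> 1" "J \<ge> 1" "n < N"
  shows "cost (update_row inv_cost N J X G lam n i \<alpha>s A)
    \<le> 17 * J\<^sup>2 + inv_cost J + length \<alpha>s * (26 * (N * J ^ N) + 10 * J\<^sup>2)"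
proof -
  obtain B c where Bc: "val (normal_equations N J X G A n \<alpha>s) = (B, c)"
    by fastforce
  show ?thesis
    unfolding update_row_def cost_simps Bc prod.case
    using cost_normal_equations_le[OF assms, of X G A \<alpha>s] cost_add_to_diagonal_le[of J lam B]
      cost_write_row_le[OF assms(2), of n i c
        "val (invert inv_cost J (val (add_to_diagonal J lam B)))" A]
      self_le_power_nat[of 2 J] \<open>J \<ge> 1\<close>
    by linarith
qed

section \<open>Slices of the observable set and the cost of updating all factor matrices\<close>

lemma finite_tuples: "finite (tuples N I)"
  unfolding tuples_def
  using finite_lists_length_eq[of "{..<I}" N] by (simp add: conj_commute)

lemma card_tuples: "card (tuples N I) = I ^ N"
  unfolding tuples_def
  using card_lists_length_eq[of "{..<I}" N] by (simp add: conj_commute)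

lemma length_enumerates: "enumerates xs S \<Longrightarrow> length xs = card S"
  unfolding enumerates_def using distinct_card by force

text \<open>The slices are the fibres of the \<open>n\<close>-th coordinate map, whose values on
  \<Omega> lie below \<open>I\<close>, so they partition \<Omega>.\<close>

lemma sum_card_slices:
  assumes "\<Omega> \<subseteq> tuples N I" "n < N"
  shows "(\<Sum>i<I. card {\<alpha> \<in> \<Omega>. \<alpha> ! n = i}) = card \<Omega>"
proof -
  have "finite \<Omega>"
    using assms finite_tuples finite_subset by blast
  moreover have "(\<lambda>\<alpha>. \<alpha> ! n) ` \<Omega> \<subseteq> {..<I}"
    using assms by (auto simp: tuples_def subset_iff)
  ultimately show ?thesis
    using sum.group[of \<Omega> "{..<I}" "\<lambda>\<alpha>. \<alpha> ! n" "\<lambda>_. 1 :: nat"] by simp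
qed

lemma cost_update_factors_le:
  assumes "N \<ge> 1" "I \<ge> 1" "J \<ge> 1" "\<Omega> \<subseteq> tuples N I"
    and slices: "\<forall>n<N. \<forall>i<I. enumerates (slices n i) {\<alpha> \<in> \<Omega>. \<alpha> ! n = i}"
  shows "cost (update_factors inv_cost N I J X slices G lam A)
    \<le> N * I * (21 * J\<^sup>2 + inv_cost J) + N * card \<Omega> * (26 * (N * J ^ N) + 10 * J\<^sup>2)"
proof -
  define D where "D = 26 * (N * J ^ N) + 10 * J\<^sup>2"
  \<comment> \<open>A bound for one mode. The loop test of each row is absorbed by raising 17 to 18;
    the last 1 is the failing test of the loop over rows.\<close>
  define R where "R = I * (18 * J\<^sup>2 + inv_cost J) + card \<Omega> * D + 1"
  have J: "1 \<le> J\<^sup>2"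
    using \<open>J \<ge> 1\<close> by simp
  have "cost (for_each [0..<I] (\<lambda>i A. update_row inv_cost N J X G lam n i (slices n i) A) A)
      \<le> R" if "n < N" for n A
  proof -
    have "cost (for_each [0..<I] (\<lambda>i A. update_row inv_cost N J X G lam n i (slices n i) A) A)
      \<le> (\<Sum>i\<leftarrow>[0..<I]. 17 * J\<^sup>2 + inv_cost J + card {\<alpha> \<in> \<Omega>. \<alpha> ! n = i} * D + 1) + 1"
    proof (rule cost_for_each_le_sum_list)
      fix i A assume "i \<in> set [0..<I]"
      then have "length (slices n i) = card {\<alpha> \<in> \<Omega>. \<alpha> ! n = i}"
        using slices \<open>n < N\<close> by (simp add: length_enumerates)
      then show "cost (update_row inv_cost N J X G lam n i (slices n i) A)
          \<le> 17 * J\<^sup>2 + inv_cost J + card {\<alpha> \<in> \<Omega>. \<alpha> ! n = i} * D"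
        using cost_update_row_le[OF assms(1,3) \<open>n < N\<close>, of inv_cost X G lam i "slices n i" A]
        by (simp add: D_def)
    qed
    also have "\<dots> = (\<Sum>i<I. 17 * J\<^sup>2 + inv_cost J + 1 + card {\<alpha> \<in> \<Omega>. \<alpha> ! n = i} * D) + 1"
      by (simp add: interv_sum_list_conv_sum_set_nat atLeast0LessThan)
    also have "\<dots> = I * (17 * J\<^sup>2 + inv_cost J + 1) + card \<Omega> * D + 1"
      by (simp only: sum.distrib sum_distrib_right[symmetric] sum_card_slices[OF assms(4) \<open>n < N\<close>]
          sum_constant card_lessThan of_nat_id add_mult_distrib2 mult.assoc)
    also have "\<dots> \<le> R"
      unfolding R_def by (rule add_le_mono1, rule add_le_mono1, rule mult_le_mono2) (use J in simp)
    finally show ?thesis .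
  qed
  then have "cost (update_factors inv_cost N I J X slices G lam A) \<le> length [0..<N] * (R + 1) + 1"
    unfolding update_factors_def by (intro cost_for_each_le) simp
  also have "\<dots> = N * I * (18 * J\<^sup>2 + inv_cost J) + N * card \<Omega> * D + (2 * N + 1)"
    by (simp add: R_def algebra_simps)
  \<comment> \<open>The left side collects the \<open>N + 1\<close> tests of the outer loop and the
    \<open>N\<close> failing tests of the inner loops. Absorbing it turns 18 into 21.\<close>
  also have "2 * N + 1 \<le> 3 * (N * I * J\<^sup>2)"
  proof -
    have "N * 1 \<le> N * (I * J\<^sup>2)"
      using \<open>I \<ge> 1\<close> J by (intro mult_le_mono2) simp
    then show ?thesis
      using \<open>N \<ge> 1\<close> unfolding mult.assoc by linarith
  qed
  finally show ?thesis
    by (simp add: D_def algebra_simps)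
qed

section \<open>Cost of the reconstruction error\<close>

lemma cost_reconstruct_le:
  assumes "N \<ge> 1" "J \<ge> 1"
  shows "cost (reconstruct N J G A \<alpha>) \<le> 12 * (N * J ^ N)"
proof -
  have core: "cost (core_product N G A [0..<N] \<alpha> \<beta>) \<le> 6 * N + 2" for \<beta>
    by (rule order.trans[OF cost_core_product_le]) simp
  have "cost (reconstruct N J G A \<alpha>) \<le> J ^ N * (N + (6 * N + 3) + 1) + 1"
    unfolding reconstruct_def by (rule cost_for_each_tuple_le) (use core in simp)
  also have "\<dots> = 7 * (N * J ^ N) + 4 * J ^ N + 1"
    by (simp add: algebra_simps)
  finally show ?thesis
    using self_le_power_nat[OF assms] by linarith
qed

lemma cost_reconstruction_error_le:
  assumes "N \<ge> 1" "J \<ge> 1"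
  shows "cost (reconstruction_error N J X obs G A) \<le> 18 * (length obs * (N * J ^ N)) + 2"
proof -
  \<comment> \<open>Besides the reconstruction, an entry needs \<open>N + 1\<close> for reading the
    tensor, three arithmetic steps and a loop test. The last two units are the failing test and the
    square root.\<close>
  have "cost (reconstruction_error N J X obs G A)
      \<le> length obs * (12 * (N * J ^ N) + N + 4 + 1) + 1 + 1"
    unfolding reconstruction_error_def cost_simps
    by (intro add_mono cost_for_each_le) (use cost_reconstruct_le[OF assms] in simp_all)
  also have "12 * (N * J ^ N) + N + 4 + 1 \<le> 18 * (N * J ^ N)"
    using self_le_power_nat[OF assms] by linarith
  finally show ?thesis
    by simp
qed

section \<open>Absorbing the quadratic term and bounding the whole iteration\<close>

lemma mult_square_card_le:
  assumes "N \<ge> 1" "J \<ge> 1" "\<Omega> \<subseteq> tuples N I"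
  shows "N * card \<Omega> * J\<^sup>2 \<le> N * I * J ^ 3 + N\<^sup>2 * card \<Omega> * J ^ N"
proof (cases "N = 1")
  case True
  \<comment> \<open>The size of \<Omega> is bounded by the number \<open>I ^ N\<close> of all index
    tuples, here with exponent 1.\<close>
  have "card \<Omega> \<le> I"
    using card_mono[OF finite_tuples assms(3)] True by (simp add: card_tuples)
  moreover have "J\<^sup>2 \<le> J ^ 3"
    using \<open>J \<ge> 1\<close> by (simp add: power_increasing)
  ultimately have "card \<Omega> * J\<^sup>2 \<le> I * J ^ 3"
    by (rule mult_le_mono)
  then show ?thesis
    using True by simp
next
  case False
  have "J\<^sup>2 \<le> J ^ N"
    using False assms by (intro power_increasing) auto
  moreover have "N * card \<Omega> \<le> N\<^sup>2 * card \<Omega>"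
    using \<open>N \<ge> 1\<close> by (simp add: power2_eq_square)
  ultimately show ?thesis
    by (simp add: mult_le_mono trans_le_add2)
qed

text \<open>An explicit bound for every inversion cost. With \<open>P\<close> and \<open>Q\<close>
  the two target terms, everything but inversion adds up to \<open>33 * P + 54 * Q\<close>, and 54
  is the larger coefficient.\<close>

lemma cost_ptucker_iteration_le:
  assumes "N \<ge> 1" "I \<ge> 1" "J \<ge> 1" "\<Omega> \<subseteq> tuples N I" "enumerates obs \<Omega>"
    and "\<forall>n<N. \<forall>i<I. enumerates (slices n i) {\<alpha> \<in> \<Omega>. \<alpha> ! n = i}"
  shows "cost (ptucker_iteration inv_cost N I J X obs slices G lam A)
    \<le> N * I * inv_cost J + 54 * (N * I * J ^ 3 + N\<^sup>2 * card \<Omega> * J ^ N)"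
proof -
  define P where "P = N * I * J ^ 3"
  define Q where "Q = N\<^sup>2 * card \<Omega> * J ^ N"
  have err: "card \<Omega> * (N * J ^ N) \<le> Q"
    using \<open>N \<ge> 1\<close> by (simp add: Q_def power2_eq_square)
  have square: "N * I * J\<^sup>2 \<le> P"
    unfolding P_def using \<open>J \<ge> 1\<close> by (intro mult_le_mono2 power_increasing) auto
  have "1 \<le> P"
    using assms by (simp add: P_def)
  have B: "N * card \<Omega> * J\<^sup>2 \<le> P + Q"
    unfolding P_def Q_def using assms by (intro mult_square_card_le)
  have delta: "N * card \<Omega> * (26 * (N * J ^ N) + 10 * J\<^sup>2) = 26 * Q + 10 * (N * card \<Omega> * J\<^sup>2)"
    by (simp add: Q_def power2_eq_square algebra_simps)
  have "cost (update_factors inv_cost N I J X slices G lam A)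
      \<le> N * I * inv_cost J + 21 * (N * I * J\<^sup>2) + 26 * Q + 10 * (N * card \<Omega> * J\<^sup>2)"
    using cost_update_factors_le[OF assms(1-4,6), of inv_cost X G lam A]
    unfolding delta by (simp add: algebra_simps)
  moreover have "cost (reconstruction_error N J X obs G
      (val (update_factors inv_cost N I J X slices G lam A))) \<le> 18 * Q + 2"
    by (rule order.trans[OF cost_reconstruction_error_le[OF assms(1,3)]])
      (use err length_enumerates[OF assms(5)] in simp)
  ultimately have "cost (ptucker_iteration inv_cost N I J X obs slices G lam A)
      \<le> (N * I * inv_cost J + 21 * (N * I * J\<^sup>2) + 26 * Q + 10 * (N * card \<Omega> * J\<^sup>2))
        + (18 * Q + 2)"
    unfolding ptucker_iteration_def cost_simps add_0_right by (rule add_mono)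
  \<comment> \<open>The additive constant 2 is paid for by \<open>2 * P\<close>, which also covers
    the case of empty \<Omega>, where \<open>Q = 0\<close>.\<close>
  also have "\<dots> \<le> (N * I * inv_cost J + 21 * P + 26 * Q + 10 * (P + Q)) + (18 * Q + 2 * P)"
    using square B \<open>1 \<le> P\<close> by (intro add_mono mult_le_mono2 order.refl) simp_all
  also have "\<dots> \<le> N * I * inv_cost J + 54 * (P + Q)"
    by simp
  finally show ?thesis
    by (simp only: P_def Q_def)
qed

text \<open>Landau notation bounds \<open>f\<close> only for large arguments, whereas the theorem
  needs the inversion bound for every \<open>J \<ge> 1\<close>. The finitely many exceptions can be
  paid for by a larger constant because \<open>g\<close> is at least 1.\<close>

lemma bigo_nat_global_bound:
  fixes f g :: "nat \<Rightarrow> real"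
  assumes "f \<in> O(g)" and pos: "\<And>n. n \<ge> 1 \<Longrightarrow> g n \<ge> 1"
  obtains c where "c > 0" "\<And>n. n \<ge> 1 \<Longrightarrow> f n \<le> c * g n"
proof -
  obtain c where "c > 0" "eventually (\<lambda>n. norm (f n) \<le> c * norm (g n)) at_top"
    using landau_o.bigE[OF assms(1)] by metis
  then obtain m where m: "\<And>n. n \<ge> m \<Longrightarrow> \<bar>f n\<bar> \<le> c * \<bar>g n\<bar>"
    unfolding eventually_at_top_linorder by auto
  \<comment> \<open>A sum of absolute values dominates each exceptional value.\<close>
  define S where "S = (\<Sum>n<m. \<bar>f n\<bar>)"
  have "S \<ge> 0"
    by (simp add: S_def sum_nonneg)
  have "f n \<le> (c + S) * g n" if "n \<ge> 1" for n
  proof (cases "n < m")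
    case True
    have "f n \<le> S"
      unfolding S_def using True member_le_sum[of n "{..<m}" "\<lambda>n. \<bar>f n\<bar>"] by force
    also have "\<dots> \<le> (c + S) * 1"
      using \<open>c > 0\<close> by simp
    also have "\<dots> \<le> (c + S) * g n"
      using \<open>c > 0\<close> \<open>S \<ge> 0\<close> pos[OF that] by (intro mult_left_mono) auto
    finally show ?thesis .
  next
    case False
    have "f n \<le> c * g n"
      using m[of n] False pos[OF that] by auto
    also have "\<dots> \<le> (c + S) * g n"
      using \<open>S \<ge> 0\<close> pos[OF that] by (intro mult_right_mono) auto
    finally show ?thesis .
  qed
  then show thesis
    using that[of "c + S"] \<open>c > 0\<close> \<open>S \<ge> 0\<close> by auto
qed

theorem theorem3:
  fixes inv_cost :: "nat \<Rightarrow> nat"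
  assumes "(\<lambda>J. real (inv_cost J)) \<in> O(\<lambda>J. real J ^ 3)"
  shows "\<exists>C>0. \<forall>N\<ge>1. \<forall>I\<ge>1. \<forall>J\<ge>1.
    \<forall>(\<Omega> :: nat list set) obs slices (X :: nat list \<Rightarrow> real) (G :: nat list \<Rightarrow> real) (A :: factors) lam.
      \<Omega> \<subseteq> tuples N I \<longrightarrow>
      enumerates obs \<Omega> \<longrightarrow>
      (\<forall>n<N. \<forall>i<I. enumerates (slices n i) {\<alpha> \<in> \<Omega>. \<alpha> ! n = i}) \<longrightarrow>
      lam > 0 \<longrightarrow>
      real (cost (ptucker_iteration inv_cost N I J X obs slices G lam A))
        \<le> C * (real N * real I * real J ^ 3 + (real N)\<^sup>2 * real (card \<Omega>) * real J ^ N)"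
proof -
  obtain c where "c > 0" and c: "\<And>J. J \<ge> 1 \<Longrightarrow> real (inv_cost J) \<le> c * real J ^ 3"
    using bigo_nat_global_bound[OF assms] by (auto simp: one_le_power)
  show ?thesis
  \<comment> \<open>The share \<open>c\<close> pays for the inversions and 54 for the rest. Since
    \<open>c\<close> is obtained from \<open>inv_cost\<close> alone, the constant is uniform in all
    the other data.\<close>
  proof (intro exI[of _ "c + 54"] conjI allI impI)
    show "c + 54 > 0"
      using \<open>c > 0\<close> by simp
    fix N I J :: nat and \<Omega> :: "nat list set" and obs slices
      and X G :: "nat list \<Rightarrow> real" and A :: factors and lam :: real
    assume *: "N \<ge> 1" "I \<ge> 1" "J \<ge> 1" "\<Omega> \<subseteq> tuples N I" "enumerates obs \<Omega>"
      "\<forall>n<N. \<forall>i<I. enumerates (slices n i) {\<alpha> \<in> \<Omega>. \<alpha> ! n = i}"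
    define P where "P = real N * real I * real J ^ 3"
    define Q where "Q = (real N)\<^sup>2 * real (card \<Omega>) * real J ^ N"
    have "real (cost (ptucker_iteration inv_cost N I J X obs slices G lam A))
      \<le> real (N * I * inv_cost J + 54 * (N * I * J ^ 3 + N\<^sup>2 * card \<Omega> * J ^ N))"
      using cost_ptucker_iteration_le[OF *] by (rule of_nat_mono)
    also have "\<dots> = real N * real I * real (inv_cost J) + 54 * (P + Q)"
      by (simp add: P_def Q_def)
    also have "real N * real I * real (inv_cost J) \<le> real N * real I * (c * real J ^ 3)"
      using c[OF \<open>J \<ge> 1\<close>] by (intro mult_left_mono) auto
    also have "\<dots> = c * P"
      by (simp add: P_def)
    also have "c * P \<le> c * (P + Q)"
      using \<open>c > 0\<close> by (simp add: Q_def)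
    finally show "real (cost (ptucker_iteration inv_cost N I J X obs slices G lam A))
        \<le> (c + 54) * (real N * real I * real J ^ 3 + (real N)\<^sup>2 * real (card \<Omega>) * real J ^ N)"
      by (simp add: P_def Q_def distrib_right)
  qed
qed

end
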